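(* Let $D\subseteq\mathbb{C}$ be open, let $\varphi_1,\varphi_2,\psi$ be analytic functions on $D$, let $\alpha,\beta\in\mathbb{R}^{+}\setminus\{1\}$, and for $n=0,1,2,\dots$ let $\Theta_n(x)=\alpha^{\varphi_1(x)}\frac{d^n}{dx^n}\left(\psi(x)\beta^{-\varphi_2(x)}\right)$. Then for all $n\ge 0$ and $x\in D$, $$\Theta_n'(x)=\Theta_{n+1}(x)+\ln\alpha\,\varphi_1'(x)\,\Theta_n(x).$$
   Context: For $c>0$ and $w\in\mathbb{C}$, $c^{w}=e^{w\ln c}$ with $\ln$ the real natural logarithm. Primes denote derivatives with respect to $x$. *)

theory Defs
  imports "HOL-Complex_Analysis.Complex_Analysis"
begin

(* For a positive real base, complex powr is the power c^w = e^(w ln c) with the real logarithm. *)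
lemma of_real_powr_eq_exp_ln:
  fixes c :: real and w :: complex
  assumes "c > 0"
  shows "of_real c powr w = exp (w * of_real (ln c))"
  using assms by (simp add: powr_def Ln_of_real)

(* The functions are total on the complex numbers, but complex derivatives at a point of an open
   set D depend only on values in D, so for x in D and every n the value does not depend on the
   functions outside D. *)
definition Theta ::
  "real \<Rightarrow> real \<Rightarrow> (complex \<Rightarrow> complex) \<Rightarrow> (complex \<Rightarrow> complex) \<Rightarrow> (complex \<Rightarrow> complex) \<Rightarrow>
    nat \<Rightarrow> complex \<Rightarrow> complex"
where
  "Theta \<alpha> \<beta> \<phi>\<^sub>1 \<phi>\<^sub>2 \<psi> n x =
     of_real \<alpha> powr \<phi>\<^sub>1 x * (deriv ^^ n) (\<lambda>t. \<psi> t * of_real \<beta> powr (- \<phi>\<^sub>2 t)) x"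

end

theory Submission
  imports Defs
begin

text \<open>This is the product rule. Since both bases are positive, the powers are exponentials, so
  \<open>Theta\<close> at index n is exp(\<open>\<phi>\<^sub>1\<close> ln \<alpha>) times the n-th
  derivative of one fixed function f, holomorphic on D. Differentiating the second factor raises n
  by one; differentiating the first reproduces it with the factor ln \<alpha> times the derivative
  of \<open>\<phi>\<^sub>1\<close>. The analytic input is \<open>holomorphic_higher_deriv\<close>:
  every iterated derivative of f is again holomorphic on the open set D. Differentiability is
  claimed separately because \<open>deriv\<close> is total, so an equation for its value alone would
  not give it.\<close>

theorem theorem3:
  fixes D :: "complex set"
    and \<phi>\<^sub>1 \<phi>\<^sub>2 \<psi> :: "complex \<Rightarrow> complex"
    and \<alpha> \<beta> :: real
  assumes "open D"
    and "\<phi>\<^sub>1 analytic_on D" and "\<phi>\<^sub>2 analytic_on D" and "\<psi> analytic_on D"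
    and "\<alpha> > 0" and "\<alpha> \<noteq> 1" and "\<beta> > 0" and "\<beta> \<noteq> 1"
  shows "\<forall>n. \<forall>x\<in>D.
    Theta \<alpha> \<beta> \<phi>\<^sub>1 \<phi>\<^sub>2 \<psi> n field_differentiable at x \<and>
    deriv (Theta \<alpha> \<beta> \<phi>\<^sub>1 \<phi>\<^sub>2 \<psi> n) x =
      Theta \<alpha> \<beta> \<phi>\<^sub>1 \<phi>\<^sub>2 \<psi> (Suc n) x
      + of_real (ln \<alpha>) * deriv \<phi>\<^sub>1 x * Theta \<alpha> \<beta> \<phi>\<^sub>1 \<phi>\<^sub>2 \<psi> n x"
proof (intro allI ballI)
  fix n x assume "x \<in> D"
  define f where "f = (\<lambda>t. \<psi> t * exp (- \<phi>\<^sub>2 t * of_real (ln \<beta>)))"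
  \<comment> \<open>The rewriting to \<open>exp\<close> is valid at every complex t, not only on D,
    so it may be done inside the iterated \<open>deriv\<close>.\<close>
  have Theta_eq: "Theta \<alpha> \<beta> \<phi>\<^sub>1 \<phi>\<^sub>2 \<psi> k
      = (\<lambda>t. exp (\<phi>\<^sub>1 t * of_real (ln \<alpha>)) * (deriv ^^ k) f t)" for k
    using assms by (simp add: Theta_def f_def of_real_powr_eq_exp_ln fun_eq_iff)
  have "f holomorphic_on D"
    unfolding f_def using assms by (intro holomorphic_intros analytic_imp_holomorphic)
  then have "(deriv ^^ n) f holomorphic_on D"
    using \<open>open D\<close> by (rule holomorphic_higher_deriv)
  then have f: "((deriv ^^ n) f has_field_derivative (deriv ^^ Suc n) f x) (at x)"
    using holomorphic_derivI[OF _ \<open>open D\<close> \<open>x \<in> D\<close>] by simp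
  have \<phi>: "(\<phi>\<^sub>1 has_field_derivative deriv \<phi>\<^sub>1 x) (at x)"
    using assms \<open>x \<in> D\<close> by (intro holomorphic_derivI[of _ D] analytic_imp_holomorphic)
  have "(Theta \<alpha> \<beta> \<phi>\<^sub>1 \<phi>\<^sub>2 \<psi> n has_field_derivative
      Theta \<alpha> \<beta> \<phi>\<^sub>1 \<phi>\<^sub>2 \<psi> (Suc n) x
      + of_real (ln \<alpha>) * deriv \<phi>\<^sub>1 x * Theta \<alpha> \<beta> \<phi>\<^sub>1 \<phi>\<^sub>2 \<psi> n x) (at x)"
    \<comment> \<open>\<open>Theta_eq\<close> is used at both n and \<open>Suc n\<close>, so the
      (n+1)-st derivative supplied by \<open>f\<close> matches the first summand.\<close>
    unfolding Theta_eq by (rule derivative_eq_intros f \<phi> refl | simp)+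
  then show "Theta \<alpha> \<beta> \<phi>\<^sub>1 \<phi>\<^sub>2 \<psi> n field_differentiable at x \<and>
    deriv (Theta \<alpha> \<beta> \<phi>\<^sub>1 \<phi>\<^sub>2 \<psi> n) x =
      Theta \<alpha> \<beta> \<phi>\<^sub>1 \<phi>\<^sub>2 \<psi> (Suc n) x
      + of_real (ln \<alpha>) * deriv \<phi>\<^sub>1 x * Theta \<alpha> \<beta> \<phi>\<^sub>1 \<phi>\<^sub>2 \<psi> n x"
    using DERIV_imp_deriv field_differentiable_def by blast
qed

end
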